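(* For every integer $n\ge 0$, $$F_{n+1}=\sum_{i=0}^{n}(-2)^{n-i}L_{i+1}=\frac13\sum_{i=0}^{n}\left(-\frac13\right)^{n-i}L_{i+2}=\frac14\sum_{i=0}^{n}\left(-\frac34\right)^{n-i}L_{i+3}=\frac17\sum_{i=0}^{n}\left(-\frac47\right)^{n-i}L_{i+4}.$$
   Context: $F_n$ denotes the Fibonacci numbers: $F_0=0$, $F_1=1$, $F_n=F_{n-1}+F_{n-2}$. $L_n$ denotes the Lucas numbers: $L_0=2$, $L_1=1$, $L_n=L_{n-1}+L_{n-2}$. *)

theory Defs
  imports Complex_Main "HOL-Number_Theory.Fib"
begin

fun lucas :: "nat \<Rightarrow> nat" where
  "lucas 0 = 2"
| "lucas (Suc 0) = 1"
| "lucas (Suc (Suc n)) = lucas (Suc n) + lucas n"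

end

theory Submission
  imports Defs
begin

text \<open>
  The four sums are the cases \<open>k = 0, 1, 2, 3\<close> of one identity. The addition formula
  \<open>lucas_add\<close> expresses a Lucas number through two consecutive Fibonacci numbers:
  \<open>L\<^sub>n\<^sub>+\<^sub>k\<^sub>+\<^sub>1 = L\<^sub>k\<^sub>+\<^sub>1 F\<^sub>n\<^sub>+\<^sub>1 + L\<^sub>k F\<^sub>n\<close>. Dividing by \<open>L\<^sub>k\<^sub>+\<^sub>1\<close> turns this into the first-order recurrence
  \<open>F\<^sub>n\<^sub>+\<^sub>1 = q F\<^sub>n + L\<^sub>n\<^sub>+\<^sub>k\<^sub>+\<^sub>1 / L\<^sub>k\<^sub>+\<^sub>1\<close> with constant ratio \<open>q = - L\<^sub>k / L\<^sub>k\<^sub>+\<^sub>1\<close>, and unrolling it down to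
  \<open>F\<^sub>0 = 0\<close> yields the weighted sum of Lucas numbers in \<open>geometric_lucas_sum\<close>. The ratios
  \<open>-2, -1/3, -3/4, -4/7\<close> and the factors \<open>1, 1/3, 1/4, 1/7\<close> come from
  \<open>L\<^sub>0, \<dots>, L\<^sub>4 = 2, 1, 3, 4, 7\<close>.
\<close>

lemma lucas_add: "lucas (n + k + 1) = lucas (k + 1) * fib (n + 1) + lucas k * fib n"
  by (induction n rule: fib.induct) (simp_all add: algebra_simps)

lemma lucas_pos: "lucas n > 0"
  by (induction n rule: lucas.induct) auto

lemma geometric_lucas_sum:
  "(\<Sum>i=0..n. (- (real (lucas k) / real (lucas (k + 1)))) ^ (n - i) * real (lucas (i + k + 1)))
     = real (lucas (k + 1)) * real (fib (n + 1))"
proof (induction n)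
  case 0
  then show ?case by simp
next
  case (Suc n)
  let ?q = "- (real (lucas k) / real (lucas (k + 1)))"
  have nz: "real (lucas (k + 1)) \<noteq> 0"
    using lucas_pos[of "k + 1"] by simp
  \<comment> \<open>Every earlier term gains one factor of the ratio when the upper limit grows by one.\<close>
  have "(\<Sum>i=0..Suc n. ?q ^ (Suc n - i) * real (lucas (i + k + 1)))
      = ?q * (\<Sum>i=0..n. ?q ^ (n - i) * real (lucas (i + k + 1))) + real (lucas (Suc n + k + 1))"
    by (simp add: sum_distrib_left Suc_diff_le mult.assoc del: lucas.simps)
  also have "\<dots> = - real (lucas k) * real (fib (n + 1)) + real (lucas (Suc n + k + 1))"
    unfolding Suc.IH using nz by (simp add: field_simps del: lucas.simps)
  also have "\<dots> = real (lucas (k + 1)) * real (fib (Suc n + 1))"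
    unfolding lucas_add by (simp add: algebra_simps del: lucas.simps fib.simps)
  finally show ?case .
qed

theorem mainTheorem1:
  fixes n :: nat
  shows "real (fib (n + 1)) = (\<Sum>i=0..n. (-2) ^ (n - i) * real (lucas (i + 1)))
    \<and> (\<Sum>i=0..n. (-2) ^ (n - i) * real (lucas (i + 1)))
        = 1 / 3 * (\<Sum>i=0..n. (- (1 / 3)) ^ (n - i) * real (lucas (i + 2)))
    \<and> 1 / 3 * (\<Sum>i=0..n. (- (1 / 3)) ^ (n - i) * real (lucas (i + 2)))
        = 1 / 4 * (\<Sum>i=0..n. (- (3 / 4)) ^ (n - i) * real (lucas (i + 3)))
    \<and> 1 / 4 * (\<Sum>i=0..n. (- (3 / 4)) ^ (n - i) * real (lucas (i + 3)))
        = 1 / 7 * (\<Sum>i=0..n. (- (4 / 7)) ^ (n - i) * real (lucas (i + 4)))"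
proof -
  have "lucas 0 = 2" "lucas 1 = 1" "lucas 2 = 3" "lucas 3 = 4" "lucas 4 = 7"
    by (simp_all add: numeral_eq_Suc)
  then show ?thesis
    using geometric_lucas_sum[where k = 0 and n = n] geometric_lucas_sum[where k = 1 and n = n]
      geometric_lucas_sum[where k = 2 and n = n] geometric_lucas_sum[where k = 3 and n = n]
    by (simp add: add.assoc del: lucas.simps fib.simps One_nat_def add_Suc_right add_2_eq_Suc')
qed

end
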